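(* Let $k,N\ge 1$ be integers, let $x_1,\dots,x_N,y_1,\dots,y_N\in\mathbb{R}^k$, and let $m_i\ge 0$, $m_i^*\ge 0$ $(1\le i\le N)$ satisfy $\sum_{i=1}^N m_i=\sum_{i=1}^N m_i^*>0$. Put $\lambda^+=\sum_{i=1}^N m_i\delta_{x_i}$, $\lambda^-=\sum_{i=1}^N m_i^*\delta_{y_i}$ and $\lambda=\lambda^+-\lambda^-$. Then for every real $q>1$, $$\lim_{n\to\infty} n^{1-1/q}\inf_{\mu\in\mathcal{B}^{+,n}}W_q\left(\mu+\lambda^+,\mu+\lambda^-\right)=\widehat{W}^{(q)}(\lambda).$$
   Context: For $n\in\mathbb{N}$, $\mathcal{B}^{+,n}:=\{\sum_{j=1}^n\alpha_j\delta_{z_j}: z_j\in\mathbb{R}^k,\ \alpha_j\ge 0\}$ is the set of positive atomic measures on $\mathbb{R}^k$ with at most $n$ atoms (the total mass is not prescribed). For finitely supported positive measures $\sigma=\sum_i a_i\delta_{u_i}$ and $\tau=\sum_j b_j\delta_{w_j}$ of equal total mass (not necessarily 1), $W_q(\sigma,\tau):=\left(\min\sum_{i,j}|u_i-w_j|^q\pi_{i,j}\right)^{1/q}$, the minimum over matrices $\pi_{i,j}\ge0$ with $\sum_j\pi_{i,j}=a_i$ and $\sum_i\pi_{i,j}=b_j$; $|\cdot|$ is the Euclidean norm. Weighted graphs associated with $\lambda$: $\Gamma(\lambda)$ is the set of pairs $(\hat\gamma,m)$ where $\hat\gamma$ is a finite directed graph whose vertex set $V(\hat\gamma)$ is a finite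 subset of $\mathbb{R}^k$ containing $\{x_1,\dots,x_N,y_1,\dots,y_N\}$, whose edges $e\in E(\hat\gamma)$ are oriented line segments between vertices (from the tail of $e$ to the head of $e$), and $m:E(\hat\gamma)\to[0,\infty)$, $e\mapsto m_e$, is a capacity function satisfying the flow balance $$\sum_{e:\ v\text{ is the tail of }e}m_e-\sum_{e:\ v\text{ is the head of }e}m_e=\lambda(\{v\})\qquad\text{for every }v\in V(\hat\gamma).$$ With $|e|$ the length of $e$, $$\widehat{W}^{(q)}(\lambda):=\inf_{(\hat\gamma,m)\in\Gamma(\lambda)}\sum_{e\in E(\hat\gamma)}|e|\,m_e^{1/q}.$$ *)

theory Defs
  imports
    "HOL-Analysis.Analysis"
    "HOL-Library.Poly_Mapping"
    "Graph_Theory.Pair_Digraph"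
begin

text \<open>
  A finitely supported signed measure \<open>lam\<close> is represented by its finitely supported mass function
  \<open>v \<mapsto> lam({v})\<close>: thus \<open>Poly_Mapping.lookup lam v\<close> is \<open>lam({v})\<close>,
  \<open>Poly_Mapping.keys lam\<close> is the set of atoms,
  \<open>Poly_Mapping.single z a\<close> is \<open>a \<delta>\<^sub>z\<close>, and addition and subtraction are those of measures.
\<close>

type_synonym 'a atomic_measure = "'a \<Rightarrow>\<^sub>0 real"

definition sum_dirac :: "nat \<Rightarrow> (nat \<Rightarrow> real) \<Rightarrow> (nat \<Rightarrow> 'a) \<Rightarrow> 'a atomic_measure" where
  "sum_dirac n a z = (\<Sum>j = 1..n. Poly_Mapping.single (z j) (a j))"

definition pos_atomic :: "nat \<Rightarrow> 'a atomic_measure set" where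
  "pos_atomic n = {sum_dirac n \<alpha> z | \<alpha> z. \<forall>j \<in> {1..n}. 0 \<le> \<alpha> j}"

text \<open>
  Both measures are written with pairwise distinct atoms of nonzero mass, so the matrix of a plan
  is indexed by \<open>Poly_Mapping.keys \<sigma> \<times> Poly_Mapping.keys \<tau>\<close>; values of \<open>\<pi>\<close> elsewhere are irrelevant.
\<close>

definition transport_plans ::
  "'a atomic_measure \<Rightarrow> 'a atomic_measure \<Rightarrow> ('a \<Rightarrow> 'a \<Rightarrow> real) set" where
  "transport_plans \<sigma> \<tau> = {\<pi>.
     (\<forall>u \<in> Poly_Mapping.keys \<sigma>. \<forall>w \<in> Poly_Mapping.keys \<tau>. 0 \<le> \<pi> u w) \<and>
     (\<forall>u \<in> Poly_Mapping.keys \<sigma>. (\<Sum>w \<in> Poly_Mapping.keys \<tau>. \<pi> u w) = Poly_Mapping.lookup \<sigma> u) \<and>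
     (\<forall>w \<in> Poly_Mapping.keys \<tau>. (\<Sum>u \<in> Poly_Mapping.keys \<sigma>. \<pi> u w) = Poly_Mapping.lookup \<tau> w)}"

definition transport_cost ::
  "real \<Rightarrow> 'a::euclidean_space atomic_measure \<Rightarrow> 'a atomic_measure \<Rightarrow> ('a \<Rightarrow> 'a \<Rightarrow> real) \<Rightarrow> real" where
  "transport_cost q \<sigma> \<tau> \<pi> =
     (\<Sum>u \<in> Poly_Mapping.keys \<sigma>. \<Sum>w \<in> Poly_Mapping.keys \<tau>. norm (u - w) powr q * \<pi> u w)"

text \<open>
  Meant for positive measures of equal total mass. The infimum is then a minimum,
  see \<open>transport_cost_attains_INF\<close> below.
\<close>

definition wasserstein ::
  "real \<Rightarrow> 'a::euclidean_space atomic_measure \<Rightarrow> 'a atomic_measure \<Rightarrow> real" where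
  "wasserstein q \<sigma> \<tau> =
     (INF \<pi> \<in> transport_plans \<sigma> \<tau>. transport_cost q \<sigma> \<tau> \<pi>) powr (1 / q)"

text \<open>
  An oriented segment is determined by its endpoints, so an edge is the pair (tail, head).
  The set \<open>X\<close> is the prescribed set of vertices \<open>{x\<^sub>1, \<dots>, x\<^sub>N, y\<^sub>1, \<dots>, y\<^sub>N}\<close>. It may be strictly
  larger than \<open>Poly_Mapping.keys lam\<close>, as masses may vanish or cancel. Only the values of \<open>c\<close> on edges matter.
\<close>

definition weighted_graphs ::
  "'a set \<Rightarrow> 'a atomic_measure \<Rightarrow> ('a pair_pre_digraph \<times> ('a \<times> 'a \<Rightarrow> real)) set" where
  "weighted_graphs X lam = {(G, c).
     pair_fin_digraph G \<and> X \<subseteq> pverts G \<and> (\<forall>e \<in> parcs G. 0 \<le> c e) \<and>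
     (\<forall>v \<in> pverts G.
        (\<Sum>e \<in> out_arcs (with_proj G) v. c e) - (\<Sum>e \<in> in_arcs (with_proj G) v. c e)
          = Poly_Mapping.lookup lam v)}"

definition network_cost ::
  "real \<Rightarrow> 'a::euclidean_space set \<Rightarrow> 'a atomic_measure \<Rightarrow> real" where
  "network_cost q X lam =
     (INF (G, c) \<in> weighted_graphs X lam. \<Sum>e \<in> parcs G. norm (snd e - fst e) * c e powr (1 / q))"

lemma transport_plans_bounds:
  fixes \<sigma> \<tau> :: "'a atomic_measure"
  assumes "\<pi> \<in> transport_plans \<sigma> \<tau>" "u \<in> Poly_Mapping.keys \<sigma>" "w \<in> Poly_Mapping.keys \<tau>"
  shows "\<pi> u w \<in> {0..Poly_Mapping.lookup \<sigma> u}"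
proof -
  have "\<pi> u w \<le> (\<Sum>w \<in> Poly_Mapping.keys \<tau>. \<pi> u w)"
    by (rule member_le_sum) (use assms in \<open>auto simp: transport_plans_def\<close>)
  then show ?thesis
    using assms by (auto simp: transport_plans_def)
qed

lemma transport_plans_nonempty:
  fixes \<sigma> \<tau> :: "'a atomic_measure"
  assumes pos: "\<And>v. 0 \<le> Poly_Mapping.lookup \<sigma> v" "\<And>v. 0 \<le> Poly_Mapping.lookup \<tau> v"
    and mass: "(\<Sum>v \<in> Poly_Mapping.keys \<sigma>. Poly_Mapping.lookup \<sigma> v) = (\<Sum>v \<in> Poly_Mapping.keys \<tau>. Poly_Mapping.lookup \<tau> v)"
  shows "transport_plans \<sigma> \<tau> \<noteq> {}"
proof -
  define M where "M = (\<Sum>v \<in> Poly_Mapping.keys \<sigma>. Poly_Mapping.lookup \<sigma> v)"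
  define \<pi> where "\<pi> = (\<lambda>u w. Poly_Mapping.lookup \<sigma> u * Poly_Mapping.lookup \<tau> w / M)"
  have M0: "M \<noteq> 0" if "u \<in> Poly_Mapping.keys \<sigma>" for u
    using that pos(1) by (auto simp: M_def sum_nonneg_eq_0_iff in_keys_iff)
  have M0': "M \<noteq> 0" if "u \<in> Poly_Mapping.keys \<tau>" for u
    using that pos(2) by (auto simp: M_def mass sum_nonneg_eq_0_iff in_keys_iff)
  have 1: "(\<Sum>w \<in> Poly_Mapping.keys \<tau>. \<pi> u w) = Poly_Mapping.lookup \<sigma> u" if "u \<in> Poly_Mapping.keys \<sigma>" for u
  proof -
    have "(\<Sum>w \<in> Poly_Mapping.keys \<tau>. \<pi> u w) = Poly_Mapping.lookup \<sigma> u * (\<Sum>w \<in> Poly_Mapping.keys \<tau>. Poly_Mapping.lookup \<tau> w) / M"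
      by (simp add: \<pi>_def sum_distrib_left sum_divide_distrib)
    then show ?thesis using M0[OF that] mass by (simp add: M_def)
  qed
  have 2: "(\<Sum>u \<in> Poly_Mapping.keys \<sigma>. \<pi> u w) = Poly_Mapping.lookup \<tau> w" if "w \<in> Poly_Mapping.keys \<tau>" for w
  proof -
    have "(\<Sum>u \<in> Poly_Mapping.keys \<sigma>. \<pi> u w) = (\<Sum>u \<in> Poly_Mapping.keys \<sigma>. Poly_Mapping.lookup \<sigma> u) * Poly_Mapping.lookup \<tau> w / M"
      by (simp add: \<pi>_def sum_distrib_right sum_divide_distrib)
    then show ?thesis using M0'[OF that] by (simp add: M_def)
  qed
  have "0 \<le> M" unfolding M_def by (intro sum_nonneg pos)
  then have "\<pi> \<in> transport_plans \<sigma> \<tau>"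
    using 1 2 pos by (auto simp: transport_plans_def \<pi>_def)
  then show ?thesis by blast
qed

lemma transport_cost_attains_INF:
  fixes \<sigma> \<tau> :: "'a::euclidean_space atomic_measure"
  assumes pos: "\<And>v. 0 \<le> Poly_Mapping.lookup \<sigma> v" "\<And>v. 0 \<le> Poly_Mapping.lookup \<tau> v"
    and mass: "(\<Sum>v \<in> Poly_Mapping.keys \<sigma>. Poly_Mapping.lookup \<sigma> v) = (\<Sum>v \<in> Poly_Mapping.keys \<tau>. Poly_Mapping.lookup \<tau> v)"
  shows "\<exists>\<pi> \<in> transport_plans \<sigma> \<tau>.
    transport_cost q \<sigma> \<tau> \<pi> = (INF \<pi> \<in> transport_plans \<sigma> \<tau>. transport_cost q \<sigma> \<tau> \<pi>)"
proof -
  define B where "B = (\<lambda>z :: 'a \<times> 'a. if z \<in> Poly_Mapping.keys \<sigma> \<times> Poly_Mapping.keys \<tau> then {0..Poly_Mapping.lookup \<sigma> (fst z)} else {0})"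
  define S where "S = {p. (\<forall>u \<in> Poly_Mapping.keys \<sigma>. (\<Sum>w \<in> Poly_Mapping.keys \<tau>. p (u, w)) = Poly_Mapping.lookup \<sigma> u) \<and>
     (\<forall>w \<in> Poly_Mapping.keys \<tau>. (\<Sum>u \<in> Poly_Mapping.keys \<sigma>. p (u, w)) = Poly_Mapping.lookup \<tau> w)}"
  define cost where "cost = (\<lambda>p. transport_cost q \<sigma> \<tau> (curry p))"
  have "compactin (product_topology (\<lambda>_. euclidean) UNIV) (PiE UNIV B)"
    by (subst compactin_PiE) (auto simp: B_def)
  then have cB: "compact (PiE UNIV B)"
    by (simp add: euclidean_product_topology)
  have cont: "continuous_on A (\<lambda>p :: 'a \<times> 'a \<Rightarrow> real. p z)" for A z
    by (rule continuous_on_subset[OF continuous_on_product_coordinates]) auto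
  have "closed S"
    unfolding S_def Collect_conj_eq Collect_ball_eq
    by (intro closed_Int closed_INT ballI closed_Collect_eq continuous_intros cont)
  with cB have comp: "compact (PiE UNIV B \<inter> S)" by (rule compact_Int_closed)
  have cc: "continuous_on (PiE UNIV B \<inter> S) cost"
    unfolding cost_def transport_cost_def curry_def by (intro continuous_intros cont)
  have restr: "\<exists>p \<in> PiE UNIV B \<inter> S. cost p = transport_cost q \<sigma> \<tau> \<pi>"
    if "\<pi> \<in> transport_plans \<sigma> \<tau>" for \<pi>
  proof -
    let ?p = "\<lambda>z. if z \<in> Poly_Mapping.keys \<sigma> \<times> Poly_Mapping.keys \<tau> then \<pi> (fst z) (snd z) else 0"
    have "?p \<in> PiE UNIV B"
      using transport_plans_bounds[OF that] by (auto simp: B_def PiE_iff)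
    moreover have "?p \<in> S"
      using that by (auto simp: S_def transport_plans_def)
    moreover have "cost ?p = transport_cost q \<sigma> \<tau> \<pi>"
      by (simp add: cost_def transport_cost_def)
    ultimately show ?thesis by blast
  qed
  have plan: "curry p \<in> transport_plans \<sigma> \<tau>" if "p \<in> PiE UNIV B \<inter> S" for p
  proof -
    have "0 \<le> p (u, w)" if "u \<in> Poly_Mapping.keys \<sigma>" "w \<in> Poly_Mapping.keys \<tau>" for u w
    proof -
      have "p (u, w) \<in> B (u, w)" using \<open>p \<in> PiE UNIV B \<inter> S\<close> by (auto simp: PiE_iff)
      then show ?thesis using that by (simp add: B_def)
    qed
    then show ?thesis
      using that by (auto simp: S_def transport_plans_def)
  qed
  from transport_plans_nonempty[OF pos mass] restr have "PiE UNIV B \<inter> S \<noteq> {}" by blast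
  from continuous_attains_inf[OF comp this cc] obtain p
    where p: "p \<in> PiE UNIV B \<inter> S" and min: "\<And>p'. p' \<in> PiE UNIV B \<inter> S \<Longrightarrow> cost p \<le> cost p'"
    by blast
  have "transport_cost q \<sigma> \<tau> (curry p) \<le> transport_cost q \<sigma> \<tau> \<pi>"
    if \<pi>: "\<pi> \<in> transport_plans \<sigma> \<tau>" for \<pi>
  proof -
    obtain p' where "p' \<in> PiE UNIV B \<inter> S" "cost p' = transport_cost q \<sigma> \<tau> \<pi>"
      using restr[OF \<pi>] by blast
    with min[of p'] show ?thesis by (simp add: cost_def)
  qed
  then have "transport_cost q \<sigma> \<tau> (curry p) = (INF \<pi> \<in> transport_plans \<sigma> \<tau>. transport_cost q \<sigma> \<tau> \<pi>)"
    by (intro cInf_eq_minimum[symmetric] imageI plan[OF p]) auto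
  then show ?thesis using plan[OF p] by blast
qed

end

theory Submission
  imports Defs "HOL-Real_Asymp.Real_Asymp"
begin

text \<open>
  Lower bound: an optimal plan between \<open>\<mu> + lam_pos\<close> and \<open>\<mu> + lam_neg\<close> is a flow on the complete
  graph over the atoms of \<open>\<mu>\<close> and the points \<open>x\<^sub>i, y\<^sub>i\<close> whose divergence is \<open>lam\<close>. A basic solution of
  the corresponding linear program lives on at most \<open>n + 2 N\<close> edges, and the power-mean inequality
  compares \<open>\<Sum> |e| m\<^sub>e powr (1 / q)\<close> with \<open>\<Sum> |e| powr q * m\<^sub>e\<close> at the price of the factor
  \<open>(n + 2 N) powr (1 - 1 / q)\<close>.
  Upper bound: cut each edge \<open>e\<close> of a weighted graph into about \<open>n a\<^sub>e / \<Sum> a\<close> equal pieces, where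
  \<open>a\<^sub>e = |e| m\<^sub>e powr (1 / q)\<close>, put an atom of mass \<open>m\<^sub>e\<close> at every cut, and move each atom to the next one.
\<close>

section \<open>Power means and sparse solutions of linear systems\<close>

text \<open>Concavity of \<open>t powr p\<close>, in the form of Young's inequality between each
  \<open>b e\<close> and the mean \<open>M\<close>: the right-hand sides add up to exactly
  \<open>S\<close>, and splitting \<open>S\<close> as \<open>S powr p * S powr (1 - p)\<close> lets
  \<open>M powr (1 - p)\<close> cancel. It is applied with \<open>p = 1 / q\<close>, and its
  cardinality factor produces the exponent \<open>1 - 1 / q\<close> of the lower bound.\<close>

lemma sum_powr_le_powr_sum:
  fixes b :: "'i \<Rightarrow> real"
  assumes "finite E" and b: "\<And>e. e \<in> E \<Longrightarrow> 0 \<le> b e" and p: "0 \<le> p" "p \<le> 1"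
  shows "(\<Sum>e\<in>E. b e powr p) \<le> (\<Sum>e\<in>E. b e) powr p * real (card E) powr (1 - p)"
proof (cases "(\<Sum>e\<in>E. b e) = 0")
  case True
  then have "b e = 0" if "e \<in> E" for e
    using that assms by (simp add: sum_nonneg_eq_0_iff)
  then show ?thesis by simp
next
  case False
  define S where "S = (\<Sum>e\<in>E. b e)"
  define M where "M = S / real (card E)"
  have S: "0 < S"
    using False sum_nonneg[of E b] b by (simp add: S_def order_less_le)
  then have n: "0 < real (card E)"
    using \<open>finite E\<close> by (auto simp: S_def card_gt_0_iff)
  with S have M: "0 < M" by (simp add: M_def)
  have "b e powr p * M powr (1 - p) \<le> p * b e + (1 - p) * M" if "e \<in> E" for e
    using Youngs_inequality_0[of p "1 - p" "b e" M] p M b[OF that]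
    by (cases "b e = 0") auto
  then have "(\<Sum>e\<in>E. b e powr p * M powr (1 - p)) \<le> (\<Sum>e\<in>E. p * b e + (1 - p) * M)"
    by (intro sum_mono)
  also have "\<dots> = p * S + (1 - p) * (real (card E) * M)"
    by (simp add: sum.distrib S_def sum_distrib_left)
  also have "\<dots> = S"
    using n by (simp add: M_def algebra_simps)
  also have "S = S powr p * S powr (1 - p)"
    using S by (simp flip: powr_add)
  also have "S powr (1 - p) = real (card E) powr (1 - p) * M powr (1 - p)"
    using n S by (simp add: M_def powr_divide)
  finally show ?thesis
    using M by (simp add: S_def[symmetric] sum_distrib_right[symmetric] mult.assoc[symmetric])
qed

text \<open>Gaussian elimination, one equation at a time. Either the equation \<open>v\<close> is
  trivial on \<open>E\<close>, or a pivot \<open>e0\<close> eliminates one unknown, so that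
  equations and unknowns both drop by one and the strict inequality survives.\<close>

lemma underdetermined_system:
  fixes A :: "'v \<Rightarrow> 'e \<Rightarrow> real"
  assumes "finite V" "finite E" "card V < card E"
  shows "\<exists>h. (\<exists>e\<in>E. h e \<noteq> 0) \<and> (\<forall>v\<in>V. (\<Sum>e\<in>E. A v e * h e) = 0)"
  using assms
proof (induction V arbitrary: E A rule: finite_induct)
  case empty
  then show ?case by (intro exI[of _ "\<lambda>_. 1"]) (auto simp: card_gt_0_iff)
next
  case (insert v V)
  show ?case
  proof (cases "\<forall>e\<in>E. A v e = 0")
    case True
    have "\<exists>h. (\<exists>e\<in>E. h e \<noteq> 0) \<and> (\<forall>v\<in>V. (\<Sum>e\<in>E. A v e * h e) = 0)"
      using insert by auto
    with True show ?thesis by auto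
  next
    case False
    then obtain e0 where e0: "e0 \<in> E" "A v e0 \<noteq> 0" by auto
    define E' where "E' = E - {e0}"
    have E: "E = insert e0 E'" "e0 \<notin> E'" "finite E'"
      using e0 insert.prems by (auto simp: E'_def)
    have "card V < card E'"
      using insert.hyps insert.prems E by (simp add: card_insert_if)
    from insert.IH[OF \<open>finite E'\<close> this, of "\<lambda>w e. A w e - A w e0 * (A v e / A v e0)"]
    obtain h where h: "\<exists>e\<in>E'. h e \<noteq> 0"
      and h0: "\<And>w. w \<in> V \<Longrightarrow> (\<Sum>e\<in>E'. (A w e - A w e0 * (A v e / A v e0)) * h e) = 0"
      by blast
    define r where "r = (\<Sum>e\<in>E'. A v e * h e)"
    \<comment> \<open>Back substitution: the value at the pivot is the one that solves the equation
      \<open>v\<close>.\<close>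
    define h' where "h' = h(e0 := - r / A v e0)"
    have h': "(\<Sum>e\<in>E. A w e * h' e) = (\<Sum>e\<in>E'. A w e * h e) - A w e0 * r / A v e0" for w
    proof -
      have "(\<Sum>e\<in>E'. A w e * h' e) = (\<Sum>e\<in>E'. A w e * h e)"
        using E by (intro sum.cong) (auto simp: h'_def)
      then show ?thesis using E by (simp add: h'_def)
    qed
    have "(\<Sum>e\<in>E. A w e * h' e) = 0" if "w \<in> V" for w
      using h0[OF that] unfolding h' r_def
      by (simp add: left_diff_distrib sum_subtractf sum_distrib_left sum_divide_distrib mult.assoc)
    moreover have "(\<Sum>e\<in>E. A v e * h' e) = 0"
      unfolding h' r_def using e0 by simp
    moreover have "\<exists>e\<in>E. h' e \<noteq> 0"
      using h E by (auto simp: h'_def)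
    ultimately show ?thesis by blast
  qed
qed

lemma basic_feasible_solution:
  fixes A :: "'v \<Rightarrow> 'e \<Rightarrow> real" and c w :: "'e \<Rightarrow> real"
  assumes "finite V" "finite E" "\<And>e. e \<in> E \<Longrightarrow> 0 \<le> c e" "\<And>e. e \<in> E \<Longrightarrow> 0 < w e"
  shows "\<exists>E' c'. E' \<subseteq> E \<and> card E' \<le> card V \<and> (\<forall>e\<in>E'. 0 \<le> c' e) \<and>
    (\<forall>v\<in>V. (\<Sum>e\<in>E'. A v e * c' e) = (\<Sum>e\<in>E. A v e * c e)) \<and>
    (\<Sum>e\<in>E'. w e * c' e) \<le> (\<Sum>e\<in>E. w e * c e)"
  using assms(2-)
proof (induction E arbitrary: c rule: finite_psubset_induct)
  case (psubset E)
  show ?case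
  proof (cases "card E \<le> card V")
    case True
    with psubset.prems show ?thesis by (intro exI[of _ E] exI[of _ c]) auto
  next
    case False
    then obtain g where g: "\<exists>e\<in>E. g e \<noteq> 0" "\<forall>v\<in>V. (\<Sum>e\<in>E. A v e * g e) = 0"
      using underdetermined_system[OF assms(1) psubset.hyps, of A] by force
    \<comment> \<open>The kernel is symmetric, so the sign can be chosen to make the cost
      nonincreasing along \<open>h\<close>.\<close>
    define h where "h = (if (\<Sum>e\<in>E. w e * g e) \<le> 0 then g else (\<lambda>e. - g e))"
    have h: "\<exists>e\<in>E. h e \<noteq> 0" "\<forall>v\<in>V. (\<Sum>e\<in>E. A v e * h e) = 0" "(\<Sum>e\<in>E. w e * h e) \<le> 0"
      using g by (auto simp: h_def sum_negf)
    define D where "D = {e\<in>E. h e < 0}"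
    \<comment> \<open>Positivity of \<open>w\<close> enters here: a nonnegative \<open>h\<close> of
      nonpositive cost would vanish on \<open>E\<close>. So some coordinate decreases along
      \<open>h\<close>.\<close>
    have "D \<noteq> {}"
    proof
      assume "D = {}"
      then have nn: "0 \<le> w e * h e" if "e \<in> E" for e
        using that psubset.prems(2)[OF that] by (auto simp: D_def not_less intro!: mult_nonneg_nonneg)
      then have "(\<Sum>e\<in>E. w e * h e) = 0"
        using h(3) sum_nonneg[of E "\<lambda>e. w e * h e"] by fastforce
      then have "\<forall>e\<in>E. w e * h e = 0"
        using nn psubset.hyps by (simp add: sum_nonneg_eq_0_iff)
      with h(1) psubset.prems(2) show False by force
    qed
    moreover have "finite D" using psubset.hyps by (simp add: D_def)
    ultimately obtain e0 where e0: "e0 \<in> D" and min: "\<And>e. e \<in> D \<Longrightarrow> c e0 / - h e0 \<le> c e / - h e"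
      using ex_min_if_finite[of "(\<lambda>e. c e / - h e) ` D"] by (auto simp: not_less)
    \<comment> \<open>The ratio test: \<open>t\<close> is the largest step that keeps
      \<open>c + t * h\<close> nonnegative, and it brings the coordinate \<open>e0\<close> to
      zero.\<close>
    define t where "t = c e0 / - h e0"
    define c' where "c' = (\<lambda>e. c e + t * h e)"
    have e0': "e0 \<in> E" "h e0 < 0" using e0 by (auto simp: D_def)
    have t: "0 \<le> t"
      using e0' psubset.prems(1)[of e0] by (auto simp: t_def divide_nonneg_neg)
    have c'nn: "0 \<le> c' e" if "e \<in> E" for e
    proof (cases "h e < 0")
      case True
      then have "t \<le> c e / - h e" using min[of e] that by (simp add: D_def t_def)
      then have "t * - h e \<le> c e" using True by (simp add: field_simps)
      then show ?thesis by (simp add: c'_def)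
    next
      case False
      then show ?thesis using t psubset.prems(1)[OF that] by (simp add: c'_def)
    qed
    have c'0: "c' e0 = 0" using e0' by (simp add: c'_def t_def)
    have sum_c': "(\<Sum>e\<in>E - {e0}. f e * c' e) = (\<Sum>e\<in>E. f e * c e) + t * (\<Sum>e\<in>E. f e * h e)" for f
    proof -
      have "(\<Sum>e\<in>E - {e0}. f e * c' e) = (\<Sum>e\<in>E. f e * c' e)"
        using psubset.hyps c'0 by (intro sum.mono_neutral_left) auto
      then show ?thesis
        by (simp add: c'_def distrib_left sum.distrib sum_distrib_left mult.left_commute)
    qed
    have "\<exists>E' d. E' \<subseteq> E - {e0} \<and> card E' \<le> card V \<and> (\<forall>e\<in>E'. 0 \<le> d e) \<and>
      (\<forall>v\<in>V. (\<Sum>e\<in>E'. A v e * d e) = (\<Sum>e\<in>E - {e0}. A v e * c' e)) \<and>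
      (\<Sum>e\<in>E'. w e * d e) \<le> (\<Sum>e\<in>E - {e0}. w e * c' e)"
      using e0' c'nn psubset.prems(2) by (intro psubset.IH) auto
    then obtain E' d where E': "E' \<subseteq> E" "card E' \<le> card V" "\<forall>e\<in>E'. 0 \<le> d e"
      and bal: "\<forall>v\<in>V. (\<Sum>e\<in>E'. A v e * d e) = (\<Sum>e\<in>E - {e0}. A v e * c' e)"
      and cost: "(\<Sum>e\<in>E'. w e * d e) \<le> (\<Sum>e\<in>E - {e0}. w e * c' e)"
      by blast
    have "t * (\<Sum>e\<in>E. w e * h e) \<le> 0"
      using t h(3) by (simp add: mult_nonneg_nonpos)
    then have "(\<Sum>e\<in>E'. w e * d e) \<le> (\<Sum>e\<in>E. w e * c e)"
      using cost unfolding sum_c' by linarith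
    moreover have "\<forall>v\<in>V. (\<Sum>e\<in>E'. A v e * d e) = (\<Sum>e\<in>E. A v e * c e)"
      using bal h(2) unfolding sum_c' by simp
    ultimately show ?thesis using E' by blast
  qed
qed

section \<open>From transport plans to weighted graphs: the lower bound\<close>

text \<open>Flow balance becomes a linear system with one equation per vertex, whose matrix is the
  incidence matrix. This is the form that \<open>basic_feasible_solution\<close> preserves.\<close>

lemma weighted_graphs_iff:
  "(G, c) \<in> weighted_graphs X lam \<longleftrightarrow>
     finite (pverts G) \<and> finite (parcs G) \<and> parcs G \<subseteq> pverts G \<times> pverts G \<and> X \<subseteq> pverts G \<and>
     (\<forall>e \<in> parcs G. 0 \<le> c e) \<and>
     (\<forall>v \<in> pverts G. (\<Sum>e \<in> parcs G. (of_bool (fst e = v) - of_bool (snd e = v)) * c e)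
        = Poly_Mapping.lookup lam v)"
proof (cases "finite (parcs G)")
  case True
  have "(\<Sum>e \<in> out_arcs (with_proj G) v. c e) = (\<Sum>e\<in>parcs G. of_bool (fst e = v) * c e)"
    "(\<Sum>e \<in> in_arcs (with_proj G) v. c e) = (\<Sum>e\<in>parcs G. of_bool (snd e = v) * c e)" for v
    using True by (auto simp: out_arcs_def in_arcs_def intro!: sum.mono_neutral_cong_left)
  then have bal: "(\<Sum>e \<in> out_arcs (with_proj G) v. c e) - (\<Sum>e \<in> in_arcs (with_proj G) v. c e)
      = (\<Sum>e \<in> parcs G. (of_bool (fst e = v) - of_bool (snd e = v)) * c e)" for v
    by (simp add: left_diff_distrib sum_subtractf)
  have wf: "pair_fin_digraph G \<longleftrightarrow> finite (pverts G) \<and> parcs G \<subseteq> pverts G \<times> pverts G"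
    using True
    by (auto simp: pair_fin_digraph_def pair_fin_digraph_axioms_def pair_wf_digraph_def)
  show ?thesis
    unfolding weighted_graphs_def mem_Collect_eq prod.case wf bal using True by blast
qed (auto simp: weighted_graphs_def pair_fin_digraph_def pair_fin_digraph_axioms_def)

text \<open>
  The plan itself may charge about twice as many pairs as \<open>\<mu>\<close> has atoms, even when it is an extreme
  point of the transport polytope. The bound relies on identifying the atoms of the source with those
  of the target, so that only the divergence, and not \<open>\<mu>\<close>, is preserved by the reduction.
\<close>
lemma graph_of_transport_plan:
  fixes \<mu> lp lm :: "'a::euclidean_space atomic_measure"
  assumes X: "finite X" "Poly_Mapping.keys lp \<subseteq> X" "Poly_Mapping.keys lm \<subseteq> X"
    and \<pi>: "\<pi> \<in> transport_plans (\<mu> + lp) (\<mu> + lm)" and q: "1 < q"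
  shows "\<exists>(G, c) \<in> weighted_graphs X (lp - lm).
    (\<Sum>e \<in> parcs G. norm (snd e - fst e) * c e powr (1 / q))
      \<le> transport_cost q (\<mu> + lp) (\<mu> + lm) \<pi> powr (1 / q)
         * real (card (Poly_Mapping.keys \<mu>) + card X) powr (1 - 1 / q)"
proof -
  define A B V where "A = Poly_Mapping.keys (\<mu> + lp)" and "B = Poly_Mapping.keys (\<mu> + lm)"
    and "V = Poly_Mapping.keys \<mu> \<union> X"
  define c where "c = (\<lambda>e :: 'a \<times> 'a. \<pi> (fst e) (snd e))"
  define w where "w = (\<lambda>e :: 'a \<times> 'a. norm (snd e - fst e) powr q)"
  define inc where "inc = (\<lambda>v (e :: 'a \<times> 'a). of_bool (fst e = v) - of_bool (snd e = v) :: real)"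
  \<comment> \<open>Diagonal pairs have zero cost and zero incidence, so removing them changes
    nothing, and it makes \<open>w\<close> strictly positive on the remaining edges.\<close>
  define E where "E = {e \<in> A \<times> B. fst e \<noteq> snd e}"
  have fin: "finite A" "finite B" "finite V" "finite E"
    using X by (auto simp: A_def B_def V_def E_def)
  have AB: "A \<subseteq> V" "B \<subseteq> V"
    using X keys_add[of \<mu>] by (fastforce simp: A_def B_def V_def)+
  have \<pi>': "\<And>u v. u \<in> A \<Longrightarrow> v \<in> B \<Longrightarrow> 0 \<le> \<pi> u v"
    "\<And>u. u \<in> A \<Longrightarrow> (\<Sum>v\<in>B. \<pi> u v) = Poly_Mapping.lookup (\<mu> + lp) u"
    "\<And>v. v \<in> B \<Longrightarrow> (\<Sum>u\<in>A. \<pi> u v) = Poly_Mapping.lookup (\<mu> + lm) v"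
    using \<pi> by (auto simp: transport_plans_def A_def B_def)
  have offdiag: "(\<Sum>e\<in>E. f e * c e) = (\<Sum>u\<in>A. \<Sum>v\<in>B. f (u, v) * \<pi> u v)"
    if "\<And>u. f (u, u) = 0" for f
  proof -
    have "(\<Sum>e\<in>E. f e * c e) = (\<Sum>e\<in>A \<times> B. f e * c e)"
      using that fin by (intro sum.mono_neutral_left) (auto simp: E_def)
    then show ?thesis by (simp add: sum.cartesian_product c_def case_prod_unfold)
  qed
  \<comment> \<open>Outflow is a row sum of the plan and inflow a column sum, so
    \<open>\<mu>\<close> cancels in the difference.\<close>
  have bal: "(\<Sum>e\<in>E. inc v e * c e) = Poly_Mapping.lookup (lp - lm) v" for v
  proof -
    have "(\<Sum>e\<in>E. inc v e * c e)
        = (\<Sum>u\<in>A. of_bool (u = v) * (\<Sum>w\<in>B. \<pi> u w)) - (\<Sum>w\<in>B. of_bool (w = v) * (\<Sum>u\<in>A. \<pi> u w))"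
      by (subst offdiag)
        (simp_all add: inc_def left_diff_distrib sum_subtractf sum_distrib_left sum.swap[of _ B A])
    also have "\<dots> = (\<Sum>u\<in>A. of_bool (u = v) * Poly_Mapping.lookup (\<mu> + lp) u)
        - (\<Sum>w\<in>B. of_bool (w = v) * Poly_Mapping.lookup (\<mu> + lm) w)"
      using \<pi>' by simp
    also have "\<dots> = Poly_Mapping.lookup (\<mu> + lp) v - Poly_Mapping.lookup (\<mu> + lm) v"
      using fin by (auto simp: of_bool_def if_distrib[of "\<lambda>x. x * _"] A_def B_def not_in_keys_iff_lookup_eq_zero cong: if_cong)
    finally show ?thesis by (simp add: lookup_add lookup_minus)
  qed
  have "\<exists>E' c'. E' \<subseteq> E \<and> card E' \<le> card V \<and> (\<forall>e\<in>E'. 0 \<le> c' e) \<and>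
    (\<forall>v\<in>V. (\<Sum>e\<in>E'. inc v e * c' e) = (\<Sum>e\<in>E. inc v e * c e)) \<and>
    (\<Sum>e\<in>E'. w e * c' e) \<le> (\<Sum>e\<in>E. w e * c e)"
    using fin \<pi>' by (intro basic_feasible_solution) (auto simp: E_def c_def w_def)
  then obtain E' c' where E': "E' \<subseteq> E" "card E' \<le> card V" "\<And>e. e \<in> E' \<Longrightarrow> 0 \<le> c' e"
    "\<And>v. v \<in> V \<Longrightarrow> (\<Sum>e\<in>E'. inc v e * c' e) = Poly_Mapping.lookup (lp - lm) v"
    "(\<Sum>e\<in>E'. w e * c' e) \<le> (\<Sum>e\<in>E. w e * c e)"
    unfolding bal by blast
  have "finite E'" using E'(1) fin(4) by (rule finite_subset)
  define G where "G = \<lparr>pverts = V, parcs = E'\<rparr>"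
  have "(G, c') \<in> weighted_graphs X (lp - lm)"
    using E' AB fin \<open>finite E'\<close> unfolding weighted_graphs_iff G_def inc_def
    by (auto simp: V_def E_def)
  moreover have "(\<Sum>e\<in>E'. norm (snd e - fst e) * c' e powr (1 / q))
      \<le> transport_cost q (\<mu> + lp) (\<mu> + lm) \<pi> powr (1 / q)
         * real (card (Poly_Mapping.keys \<mu>) + card X) powr (1 - 1 / q)"
  proof -
    \<comment> \<open>Each network term is the power \<open>1 / q\<close> of the corresponding
      transport term, so the power-mean inequality compares the two sums.\<close>
    have "(\<Sum>e\<in>E'. norm (snd e - fst e) * c' e powr (1 / q)) = (\<Sum>e\<in>E'. (w e * c' e) powr (1 / q))"
      using E' q by (intro sum.cong) (auto simp: w_def powr_mult powr_powr)
    also have "\<dots> \<le> (\<Sum>e\<in>E'. w e * c' e) powr (1 / q) * real (card E') powr (1 - 1 / q)"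
      using E' q \<open>finite E'\<close> by (intro sum_powr_le_powr_sum) (auto simp: w_def)
    also have "\<dots> \<le> (\<Sum>e\<in>E. w e * c e) powr (1 / q)
         * real (card (Poly_Mapping.keys \<mu>) + card X) powr (1 - 1 / q)"
      using E' q card_Un_le[of "Poly_Mapping.keys \<mu>" X]
      by (intro mult_mono powr_mono2 sum_nonneg) (auto simp: w_def V_def)
    also have "(\<Sum>e\<in>E. w e * c e) = transport_cost q (\<mu> + lp) (\<mu> + lm) \<pi>"
      by (subst offdiag) (simp_all add: w_def transport_cost_def A_def B_def norm_minus_commute)
    finally show ?thesis .
  qed
  ultimately show ?thesis by (auto simp: G_def intro!: bexI[of _ "(G, c')"])
qed

section \<open>Atomic measures and plans given by moves\<close>

lemma keys_sum_dirac: "Poly_Mapping.keys (sum_dirac n a z) \<subseteq> z ` {1..n}"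
  unfolding sum_dirac_def by (rule order_trans[OF keys_sum]) (auto split: if_splits)

lemma sum_lookup_sum_dirac:
  "(\<Sum>v\<in>Poly_Mapping.keys (sum_dirac n a z). Poly_Mapping.lookup (sum_dirac n a z) v) = (\<Sum>j = 1..n. a j)"
proof -
  have "(\<Sum>v\<in>Poly_Mapping.keys (sum_dirac n a z). Poly_Mapping.lookup (sum_dirac n a z) v)
      = (\<Sum>v\<in>z ` {1..n}. Poly_Mapping.lookup (sum_dirac n a z) v)"
    by (intro sum.mono_neutral_left keys_sum_dirac) (auto simp: in_keys_iff)
  also have "\<dots> = (\<Sum>j = 1..n. \<Sum>v\<in>z ` {1..n}. if z j = v then a j else 0)"
    unfolding sum_dirac_def lookup_sum lookup_single when_def by (rule sum.swap)
  also have "\<dots> = (\<Sum>j = 1..n. a j)"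
    by (intro sum.cong refl) auto
  finally show ?thesis .
qed

text \<open>Coinciding points merge and zero masses vanish, so a representation has at least as many
  terms as atoms. Conversely, an enumeration of the atoms is padded with zero masses up to length
  \<open>n\<close>.\<close>

lemma pos_atomic_iff:
  "\<mu> \<in> pos_atomic n \<longleftrightarrow> (\<forall>v. 0 \<le> Poly_Mapping.lookup \<mu> v) \<and> card (Poly_Mapping.keys \<mu>) \<le> n"
proof safe
  assume "\<mu> \<in> pos_atomic n"
  then obtain \<alpha> z where \<mu>: "\<mu> = sum_dirac n \<alpha> z" and \<alpha>: "\<forall>j\<in>{1..n}. 0 \<le> \<alpha> j"
    by (auto simp: pos_atomic_def)
  show "0 \<le> Poly_Mapping.lookup \<mu> v" for v
    using \<alpha> by (auto simp: \<mu> sum_dirac_def lookup_sum lookup_single when_def intro!: sum_nonneg)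
  have "Poly_Mapping.keys \<mu> \<subseteq> z ` {1..n}"
    unfolding \<mu> by (rule keys_sum_dirac)
  then show "card (Poly_Mapping.keys \<mu>) \<le> n"
    by (metis card_atLeastAtMost diff_Suc_1 finite_atLeastAtMost surj_card_le)
next
  assume nn: "\<forall>v. 0 \<le> Poly_Mapping.lookup \<mu> v" and card: "card (Poly_Mapping.keys \<mu>) \<le> n"
  obtain z where z: "bij_betw z {1..card (Poly_Mapping.keys \<mu>)} (Poly_Mapping.keys \<mu>)"
    using ex_bij_betw_nat_finite_1[OF finite_keys[of \<mu>]] by blast
  define \<alpha> where "\<alpha> j = (if j \<le> card (Poly_Mapping.keys \<mu>) then Poly_Mapping.lookup \<mu> (z j) else 0)" for j
  have "sum_dirac n \<alpha> z = (\<Sum>j = 1..card (Poly_Mapping.keys \<mu>). Poly_Mapping.single (z j) (\<alpha> j))"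
    unfolding sum_dirac_def using card by (intro sum.mono_neutral_right) (auto simp: \<alpha>_def)
  also have "\<dots> = (\<Sum>j = 1..card (Poly_Mapping.keys \<mu>). Poly_Mapping.single (z j) (Poly_Mapping.lookup \<mu> (z j)))"
    by (intro sum.cong) (auto simp: \<alpha>_def)
  also have "\<dots> = (\<Sum>v\<in>Poly_Mapping.keys \<mu>. Poly_Mapping.single v (Poly_Mapping.lookup \<mu> v))"
    by (rule sum.reindex_bij_betw[OF z])
  also have "\<dots> = \<mu>"
    by (intro poly_mapping_eqI)
      (auto simp: lookup_sum lookup_single when_def not_in_keys_iff_lookup_eq_zero)
  finally have "sum_dirac n \<alpha> z = \<mu>" .
  moreover have "\<forall>j\<in>{1..n}. 0 \<le> \<alpha> j" using nn by (simp add: \<alpha>_def)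
  ultimately show "\<mu> \<in> pos_atomic n" unfolding pos_atomic_def by blast
qed

lemma transport_cost_nonneg:
  "\<pi> \<in> transport_plans \<sigma> \<tau> \<Longrightarrow> 0 \<le> transport_cost q \<sigma> \<tau> \<pi>"
  by (auto simp: transport_plans_def transport_cost_def intro!: sum_nonneg)

text \<open>Move \<open>i\<close> carries mass \<open>p i\<close> from \<open>s i\<close> to
  \<open>t i\<close>, and the plan collects all moves with the same endpoints. Indexing by moves
  rather than by points makes it unnecessary to know which of the points coincide.\<close>

lemma transport_plan_of_moves:
  fixes s t :: "'i \<Rightarrow> 'a::euclidean_space"
  assumes "finite I" and p: "\<And>i. i \<in> I \<Longrightarrow> 0 \<le> p i"
    and \<sigma>: "\<sigma> = (\<Sum>i\<in>I. Poly_Mapping.single (s i) (p i))"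
    and \<tau>: "\<tau> = (\<Sum>i\<in>I. Poly_Mapping.single (t i) (p i))"
  shows "\<exists>\<pi> \<in> transport_plans \<sigma> \<tau>.
    transport_cost q \<sigma> \<tau> \<pi> = (\<Sum>i\<in>I. norm (s i - t i) powr q * p i)"
proof -
  define A B where "A = Poly_Mapping.keys \<sigma>" and "B = Poly_Mapping.keys \<tau>"
  have fin: "finite A" "finite B" by (auto simp: A_def B_def)
  have \<sigma>': "Poly_Mapping.lookup \<sigma> u = (\<Sum>i\<in>I. of_bool (s i = u) * p i)"
    and \<tau>': "Poly_Mapping.lookup \<tau> u = (\<Sum>i\<in>I. of_bool (t i = u) * p i)" for u
    by (auto simp: \<sigma> \<tau> lookup_sum lookup_single when_def intro!: sum.cong)
  \<comment> \<open>Masses are nonnegative, so nothing cancels and the endpoints of a move of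
    nonzero mass are atoms. Sums over \<open>A\<close> and \<open>B\<close> therefore lose only
    moves of mass zero.\<close>
  have A: "s i \<in> A" and B: "t i \<in> B" if "i \<in> I" "p i \<noteq> 0" for i
  proof -
    have "p i \<le> (\<Sum>i'\<in>I. of_bool (s i' = s i) * p i')"
      using member_le_sum[of i I "\<lambda>i'. of_bool (s i' = s i) * p i'"] that p \<open>finite I\<close> by simp
    moreover have "p i \<le> (\<Sum>i'\<in>I. of_bool (t i' = t i) * p i')"
      using member_le_sum[of i I "\<lambda>i'. of_bool (t i' = t i) * p i'"] that p \<open>finite I\<close> by simp
    ultimately show "s i \<in> A" "t i \<in> B"
      using that p[OF that(1)] by (auto simp: A_def B_def in_keys_iff \<sigma>' \<tau>')
  qed
  define \<pi> where "\<pi> = (\<lambda>u w. \<Sum>i\<in>I. of_bool (s i = u) * of_bool (t i = w) * p i)"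
  have sumB: "(\<Sum>w\<in>B. f w * (of_bool (t i = w) * p i)) = f (t i) * p i" if "i \<in> I" for f i
  proof -
    have "(\<Sum>w\<in>B. f w * (of_bool (t i = w) * p i)) = (\<Sum>w\<in>B. if t i = w then f w * p i else 0)"
      by (intro sum.cong) auto
    then show ?thesis using B[OF that] fin by auto
  qed
  have sumA: "(\<Sum>u\<in>A. f u * (of_bool (s i = u) * p i)) = f (s i) * p i" if "i \<in> I" for f i
  proof -
    have "(\<Sum>u\<in>A. f u * (of_bool (s i = u) * p i)) = (\<Sum>u\<in>A. if s i = u then f u * p i else 0)"
      by (intro sum.cong) auto
    then show ?thesis using A[OF that] fin by auto
  qed
  have "(\<Sum>w\<in>B. \<pi> u w) = Poly_Mapping.lookup \<sigma> u" for u
  proof -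
    have "(\<Sum>w\<in>B. \<pi> u w) = (\<Sum>i\<in>I. \<Sum>w\<in>B. of_bool (s i = u) * (of_bool (t i = w) * p i))"
      unfolding \<pi>_def by (subst sum.swap) (simp add: mult.assoc)
    then show ?thesis by (simp add: sumB \<sigma>')
  qed
  moreover have "(\<Sum>u\<in>A. \<pi> u w) = Poly_Mapping.lookup \<tau> w" for w
  proof -
    have "(\<Sum>u\<in>A. \<pi> u w) = (\<Sum>i\<in>I. \<Sum>u\<in>A. of_bool (t i = w) * (of_bool (s i = u) * p i))"
      unfolding \<pi>_def by (subst sum.swap) (simp add: mult_ac)
    then show ?thesis by (simp add: sumA \<tau>')
  qed
  moreover have "0 \<le> \<pi> u w" for u w
    using p by (auto simp: \<pi>_def intro!: sum_nonneg)
  ultimately have \<pi>: "\<pi> \<in> transport_plans \<sigma> \<tau>"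
    by (simp add: transport_plans_def A_def B_def)
  have "transport_cost q \<sigma> \<tau> \<pi> = (\<Sum>u\<in>A. \<Sum>w\<in>B. \<Sum>i\<in>I.
      (norm (u - w) powr q * of_bool (s i = u)) * (of_bool (t i = w) * p i))"
    unfolding transport_cost_def A_def[symmetric] B_def[symmetric] \<pi>_def
    by (simp add: sum_distrib_left mult.assoc)
  also have "\<dots> = (\<Sum>u\<in>A. \<Sum>i\<in>I. \<Sum>w\<in>B.
      (norm (u - w) powr q * of_bool (s i = u)) * (of_bool (t i = w) * p i))"
    by (intro sum.cong refl sum.swap)
  also have "\<dots> = (\<Sum>u\<in>A. \<Sum>i\<in>I. (norm (u - t i) powr q * of_bool (s i = u)) * p i)"
    by (simp only: sumB cong: sum.cong)
  also have "\<dots> = (\<Sum>i\<in>I. \<Sum>u\<in>A. norm (u - t i) powr q * (of_bool (s i = u) * p i))"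
    by (subst sum.swap) (simp only: mult.assoc)
  also have "\<dots> = (\<Sum>i\<in>I. norm (s i - t i) powr q * p i)"
    by (simp add: sumA)
  finally show ?thesis using \<pi> by blast
qed

lemma wasserstein_le:
  assumes "\<pi> \<in> transport_plans \<sigma> \<tau>" "0 < q"
  shows "wasserstein q \<sigma> \<tau> \<le> transport_cost q \<sigma> \<tau> \<pi> powr (1 / q)"
  unfolding wasserstein_def
proof (rule powr_mono2)
  have "bdd_below (transport_cost q \<sigma> \<tau> ` transport_plans \<sigma> \<tau>)"
    by (rule bdd_belowI2[where m = 0]) (rule transport_cost_nonneg)
  then show "(INF \<pi> \<in> transport_plans \<sigma> \<tau>. transport_cost q \<sigma> \<tau> \<pi>) \<le> transport_cost q \<sigma> \<tau> \<pi>"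
    using assms(1) by (rule cINF_lower)
  show "0 \<le> (INF \<pi> \<in> transport_plans \<sigma> \<tau>. transport_cost q \<sigma> \<tau> \<pi>)"
    using assms(1) by (intro cINF_greatest transport_cost_nonneg) auto
qed (use assms in simp)

section \<open>From weighted graphs to atomic measures: the upper bound\<close>

text \<open>Shifting the mass \<open>c e\<close> by one piece along all of \<open>e\<close> takes
  \<open>k e\<close> moves of length \<open>|e| / k e\<close>, which gives the factor
  \<open>k e powr (1 - q)\<close>. The net effect is to carry \<open>c e\<close> from tail to head,
  and flow balance makes the mass left at the vertices the same before and after. Each edge has
  \<open>k e - 1\<close> interior cuts, hence the number of atoms.\<close>

lemma wasserstein_subdivided_graph_le:
  fixes lp lm :: "'a::euclidean_space atomic_measure" and k :: "'a \<times> 'a \<Rightarrow> nat"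
  assumes G: "finite V" "finite E" "E \<subseteq> V \<times> V" "\<And>e. e \<in> E \<Longrightarrow> 0 \<le> c e"
    and bal: "\<And>v. v \<in> V \<Longrightarrow> (\<Sum>e\<in>E. (of_bool (fst e = v) - of_bool (snd e = v)) * c e)
        = Poly_Mapping.lookup (lp - lm) v"
    and keys: "Poly_Mapping.keys lp \<subseteq> V" "Poly_Mapping.keys lm \<subseteq> V"
    and nn: "\<And>v. 0 \<le> Poly_Mapping.lookup lp v"
    and k: "\<And>e. e \<in> E \<Longrightarrow> 1 \<le> k e" and q: "0 < q"
  shows "\<exists>\<mu> \<in> pos_atomic (card V + (\<Sum>e\<in>E. k e - 1)).
    wasserstein q (\<mu> + lp) (\<mu> + lm)
      \<le> (\<Sum>e\<in>E. norm (snd e - fst e) powr q * c e * real (k e) powr (1 - q)) powr (1 / q)"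
proof -
  define P where "P = (\<lambda>e (j::nat). fst e + (real j / real (k e)) *\<^sub>R (snd e - fst e :: 'a))"
  define F where "F = (\<lambda>e j. Poly_Mapping.single (P e j) (c e))"
  define out inn where "out = (\<lambda>v. \<Sum>e\<in>E. of_bool (fst e = v) * c e)"
    and "inn = (\<lambda>v. \<Sum>e\<in>E. of_bool (snd e = v) * c e)"
  define M where "M = (\<Sum>e\<in>E. \<Sum>j\<in>{1..<k e}. F e j)"
  \<comment> \<open>Of the mass of \<open>\<mu> + lp\<close> placed at a vertex \<open>v\<close>,
    the part \<open>out v\<close> departs along the edges and \<open>stay v\<close> remains.\<close>
  define \<mu> where "\<mu> = M + (\<Sum>v\<in>V. Poly_Mapping.single v (out v + inn v))"
  define stay where "stay = (\<lambda>v. inn v + Poly_Mapping.lookup lp v)"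
  have out_inn: "0 \<le> out v" "0 \<le> inn v" for v
    using G by (auto simp: out_def inn_def intro!: sum_nonneg)
  have outside: "out v = 0" "inn v = 0" "Poly_Mapping.lookup lp v = 0" "Poly_Mapping.lookup lm v = 0"
    if "v \<notin> V" for v
    using that G(3) keys by (auto simp: out_def inn_def in_keys_iff intro!: sum.neutral)
  \<comment> \<open>On \<open>V\<close> this is the flow balance; outside \<open>V\<close> both
    sides vanish.\<close>
  have stay: "stay v = out v + Poly_Mapping.lookup lm v" for v
  proof (cases "v \<in> V")
    case True
    then show ?thesis
      using bal[OF True] by (simp add: stay_def out_def inn_def left_diff_distrib sum_subtractf lookup_minus)
  qed (simp add: stay_def outside)
  have P_ends: "P e 0 = fst e" "P e (k e) = snd e" if "e \<in> E" for e
    using k[OF that] by (simp_all add: P_def)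
  have lookup_sum_single: "Poly_Mapping.lookup (\<Sum>v\<in>V. Poly_Mapping.single v (f v)) v = (if v \<in> V then f v else 0)" for f :: "'a \<Rightarrow> real" and v
    using G(1) by (simp add: lookup_sum lookup_single when_def)
  \<comment> \<open>Moves start at the positions \<open>0\<close>, ..., \<open>k e - 1\<close> and
    end at \<open>1\<close>, ..., \<open>k e\<close>. The interior positions are common to both and
    form \<open>M\<close>; only the tail and the head differ.\<close>
  have starts: "(\<Sum>e\<in>E. \<Sum>j<k e. F e j) = M + (\<Sum>e\<in>E. Poly_Mapping.single (fst e) (c e))"
  proof -
    have "(\<Sum>j<k e. F e j) = (\<Sum>j\<in>{1..<k e}. F e j) + Poly_Mapping.single (fst e) (c e)" if "e \<in> E" for e
    proof -
      have "{..<k e} = insert 0 {1..<k e}" using k[OF that] by auto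
      then show ?thesis using P_ends[OF that] by (simp add: F_def add.commute)
    qed
    then show ?thesis by (simp add: M_def sum.distrib)
  qed
  have ends: "(\<Sum>e\<in>E. \<Sum>j<k e. F e (Suc j)) = M + (\<Sum>e\<in>E. Poly_Mapping.single (snd e) (c e))"
  proof -
    have "(\<Sum>j<k e. F e (Suc j)) = (\<Sum>j\<in>{1..<k e}. F e j) + Poly_Mapping.single (snd e) (c e)" if "e \<in> E" for e
    proof -
      have "(\<Sum>j<k e. F e (Suc j)) = (\<Sum>j\<in>{1..k e}. F e j)"
        by (intro sum.reindex_bij_witness[of _ "\<lambda>j. j - 1" Suc]) auto
      moreover have "{1..k e} = insert (k e) {1..<k e}" using k[OF that] by auto
      ultimately show ?thesis using P_ends[OF that] by (simp add: F_def add.commute)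
    qed
    then show ?thesis by (simp add: M_def sum.distrib)
  qed
  have \<sigma>: "\<mu> + lp = (\<Sum>e\<in>E. \<Sum>j<k e. F e j) + (\<Sum>v\<in>V. Poly_Mapping.single v (stay v))"
  proof (rule poly_mapping_eqI)
    fix v
    have "Poly_Mapping.lookup (\<Sum>e\<in>E. Poly_Mapping.single (fst e) (c e)) v = out v"
      by (auto simp: lookup_sum lookup_single when_def out_def intro!: sum.cong)
    then show "Poly_Mapping.lookup (\<mu> + lp) v
        = Poly_Mapping.lookup ((\<Sum>e\<in>E. \<Sum>j<k e. F e j) + (\<Sum>v\<in>V. Poly_Mapping.single v (stay v))) v"
      unfolding starts \<mu>_def lookup_add lookup_sum_single using outside[of v] by (simp add: stay_def)
  qed
  have \<tau>: "\<mu> + lm = (\<Sum>e\<in>E. \<Sum>j<k e. F e (Suc j)) + (\<Sum>v\<in>V. Poly_Mapping.single v (stay v))"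
  proof (rule poly_mapping_eqI)
    fix v
    have "Poly_Mapping.lookup (\<Sum>e\<in>E. Poly_Mapping.single (snd e) (c e)) v = inn v"
      by (auto simp: lookup_sum lookup_single when_def inn_def intro!: sum.cong)
    then show "Poly_Mapping.lookup (\<mu> + lm) v
        = Poly_Mapping.lookup ((\<Sum>e\<in>E. \<Sum>j<k e. F e (Suc j)) + (\<Sum>v\<in>V. Poly_Mapping.single v (stay v))) v"
      unfolding ends \<mu>_def lookup_add lookup_sum_single using outside[of v] by (simp add: stay)
  qed
  \<comment> \<open>Two kinds of moves: one for each piece of each edge, and one for each vertex
    that leaves \<open>stay v\<close> in place at no cost.\<close>
  define I where "I = Sigma E (\<lambda>e. {..<k e}) <+> V"
  define s where "s = case_sum (\<lambda>(e, j). P e j) (\<lambda>v. v)"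
  define t where "t = case_sum (\<lambda>(e, j). P e (Suc j)) (\<lambda>v. v)"
  define p where "p = case_sum (\<lambda>(e, j :: nat). c e) stay"
  have I: "(\<Sum>i\<in>I. f i) = (\<Sum>e\<in>E. \<Sum>j<k e. f (Inl (e, j))) + (\<Sum>v\<in>V. f (Inr v))"
    for f :: "_ \<Rightarrow> 'b::comm_monoid_add"
    unfolding I_def using G by (simp add: sum.Plus sum.Sigma case_prod_unfold)
  have "\<exists>\<pi> \<in> transport_plans (\<mu> + lp) (\<mu> + lm).
    transport_cost q (\<mu> + lp) (\<mu> + lm) \<pi> = (\<Sum>i\<in>I. norm (s i - t i) powr q * p i)"
  proof (rule transport_plan_of_moves)
    show "finite I" using G by (simp add: I_def)
    show "0 \<le> p i" if "i \<in> I" for i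
      using that G(4) out_inn nn by (auto simp: I_def p_def stay_def)
    show "\<mu> + lp = (\<Sum>i\<in>I. Poly_Mapping.single (s i) (p i))"
      unfolding I \<sigma> by (simp add: s_def p_def F_def)
    show "\<mu> + lm = (\<Sum>i\<in>I. Poly_Mapping.single (t i) (p i))"
      unfolding I \<tau> by (simp add: t_def p_def F_def)
  qed
  then have "wasserstein q (\<mu> + lp) (\<mu> + lm) \<le> (\<Sum>i\<in>I. norm (s i - t i) powr q * p i) powr (1 / q)"
    using wasserstein_le[OF _ q] by metis
  also have "(\<Sum>i\<in>I. norm (s i - t i) powr q * p i) = (\<Sum>e\<in>E. \<Sum>j<k e. norm (P e j - P e (Suc j)) powr q * c e)"
    unfolding I by (simp add: s_def t_def p_def)
  also have "\<dots> = (\<Sum>e\<in>E. norm (snd e - fst e) powr q * c e * real (k e) powr (1 - q))"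
  proof (rule sum.cong[OF refl])
    fix e assume "e \<in> E"
    then have k0: "0 < real (k e)" using k by (metis of_nat_0_less_iff less_le_trans zero_less_one)
    have step: "norm (P e j - P e (Suc j)) = norm (snd e - fst e) / real (k e)" for j
    proof -
      have "P e j - P e (Suc j) = - ((1 / real (k e)) *\<^sub>R (snd e - fst e))"
        by (simp add: P_def add_divide_distrib scaleR_left_distrib)
      then show ?thesis by simp
    qed
    show "(\<Sum>j<k e. norm (P e j - P e (Suc j)) powr q * c e)
        = norm (snd e - fst e) powr q * c e * real (k e) powr (1 - q)"
      unfolding step using k0 by (simp add: powr_divide powr_diff field_simps)
  qed
  finally have cost: "wasserstein q (\<mu> + lp) (\<mu> + lm)
      \<le> (\<Sum>e\<in>E. norm (snd e - fst e) powr q * c e * real (k e) powr (1 - q)) powr (1 / q)" .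
  have "0 \<le> Poly_Mapping.lookup \<mu> v" for v
    using G(4) out_inn
    by (auto simp: \<mu>_def M_def F_def lookup_add lookup_sum lookup_single when_def
        intro!: add_nonneg_nonneg sum_nonneg)
  moreover have "card (Poly_Mapping.keys \<mu>) \<le> card V + (\<Sum>e\<in>E. k e - 1)"
  proof -
    have "Poly_Mapping.keys (\<Sum>j\<in>{1..<k e}. F e j) \<subseteq> P e ` {1..<k e}" for e
      by (rule order_trans[OF keys_sum]) (auto simp: F_def split: if_splits)
    then have "(\<Union>e\<in>E. Poly_Mapping.keys (\<Sum>j\<in>{1..<k e}. F e j)) \<subseteq> (\<Union>e\<in>E. P e ` {1..<k e})"
      by (rule UN_mono[OF order_refl])
    then have "Poly_Mapping.keys M \<subseteq> (\<Union>e\<in>E. P e ` {1..<k e})"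
      unfolding M_def by (rule order_trans[OF keys_sum])
    moreover have "Poly_Mapping.keys (\<Sum>v\<in>V. Poly_Mapping.single v (out v + inn v)) \<subseteq> V"
      by (auto simp: in_keys_iff lookup_sum_single split: if_splits)
    ultimately have "Poly_Mapping.keys \<mu> \<subseteq> V \<union> (\<Union>e\<in>E. P e ` {1..<k e})"
      using keys_add[of M] unfolding \<mu>_def by blast
    then have "card (Poly_Mapping.keys \<mu>) \<le> card (V \<union> (\<Union>e\<in>E. P e ` {1..<k e}))"
      using G by (intro card_mono) auto
    also have "\<dots> \<le> card V + card (\<Union>e\<in>E. P e ` {1..<k e})"
      by (rule card_Un_le)
    also have "card (\<Union>e\<in>E. P e ` {1..<k e}) \<le> (\<Sum>e\<in>E. card (P e ` {1..<k e}))"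
      using G(2) by (rule card_UN_le)
    also have "\<dots> \<le> (\<Sum>e\<in>E. k e - 1)"
      by (intro sum_mono card_image_le[THEN order_trans]) auto
    finally show ?thesis by simp
  qed
  ultimately show ?thesis using cost by (auto simp: pos_atomic_iff)
qed

lemma pos_atomic_mono: "n \<le> n' \<Longrightarrow> pos_atomic n \<subseteq> pos_atomic n'"
  by (auto simp: pos_atomic_iff)

text \<open>At most \<open>card V\<close> atoms are reserved for the vertices and the other
  \<open>T\<close> are shared among the edges. With \<open>k e\<close> at least
  \<open>T * a e / S\<close>, each edge costs at most \<open>a e * (T / S) powr (1 - q)\<close>; the
  sum is \<open>S powr q * T powr (1 - q)\<close>, whose root is the bound.\<close>

lemma INF_wasserstein_le:
  fixes lp lm :: "'a::euclidean_space atomic_measure"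
  assumes G: "finite V" "finite E" "E \<subseteq> V \<times> V" "\<And>e. e \<in> E \<Longrightarrow> 0 \<le> c e"
    and bal: "\<And>v. v \<in> V \<Longrightarrow> (\<Sum>e\<in>E. (of_bool (fst e = v) - of_bool (snd e = v)) * c e)
        = Poly_Mapping.lookup (lp - lm) v"
    and keys: "Poly_Mapping.keys lp \<subseteq> V" "Poly_Mapping.keys lm \<subseteq> V"
    and nn: "\<And>v. 0 \<le> Poly_Mapping.lookup lp v"
    and n: "card V < n" and q: "1 < q"
  shows "(INF \<mu> \<in> pos_atomic n. wasserstein q (\<mu> + lp) (\<mu> + lm))
    \<le> (\<Sum>e\<in>E. norm (snd e - fst e) * c e powr (1 / q)) * (real n - real (card V)) powr (1 / q - 1)"
proof -
  define a where "a = (\<lambda>e. norm (snd e - fst e) * c e powr (1 / q))"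
  define S where "S = (\<Sum>e\<in>E. a e)"
  define T where "T = real n - real (card V)"
  \<comment> \<open>The proportions \<open>a e / S\<close> are the optimal ones: they minimise
    \<open>\<Sum> a\<^sub>e powr q * k\<^sub>e powr (1 - q)\<close> for a given value of \<open>\<Sum> k\<^sub>e\<close>.\<close>
  define k where "k = (\<lambda>e. Suc (nat \<lfloor>T * a e / S\<rfloor>))"
  have T: "0 < T" using n by (simp add: T_def)
  have a: "0 \<le> a e" for e by (simp add: a_def)
  have S: "0 \<le> S" by (simp add: S_def a sum_nonneg)
  have "\<exists>\<mu> \<in> pos_atomic (card V + (\<Sum>e\<in>E. k e - 1)).
    wasserstein q (\<mu> + lp) (\<mu> + lm)
      \<le> (\<Sum>e\<in>E. norm (snd e - fst e) powr q * c e * real (k e) powr (1 - q)) powr (1 / q)"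
    using q by (intro wasserstein_subdivided_graph_le G bal keys nn) (auto simp: k_def)
  then obtain \<mu> where \<mu>: "\<mu> \<in> pos_atomic (card V + (\<Sum>e\<in>E. k e - 1))"
    and le: "wasserstein q (\<mu> + lp) (\<mu> + lm)
      \<le> (\<Sum>e\<in>E. norm (snd e - fst e) powr q * c e * real (k e) powr (1 - q)) powr (1 / q)"
    by blast
  \<comment> \<open>Rounding works both ways: the floor keeps the number of cuts within the budget
    \<open>T\<close>, while \<open>Suc\<close> keeps \<open>k e\<close> above
    \<open>T * a e / S\<close>. For \<open>S = 0\<close> the quotients are zero and no edge is
    cut.\<close>
  have "real (\<Sum>e\<in>E. k e - 1) \<le> (\<Sum>e\<in>E. T * a e / S)"
    using T S a by (auto simp: k_def intro!: sum_mono)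
  also have "\<dots> = T * S / S"
    by (simp add: S_def sum_distrib_left sum_divide_distrib)
  also have "\<dots> \<le> T" using T by simp
  finally have "real (card V + (\<Sum>e\<in>E. k e - 1)) \<le> real n"
    unfolding T_def of_nat_add by linarith
  then have "card V + (\<Sum>e\<in>E. k e - 1) \<le> n" by (simp only: of_nat_le_iff)
  with \<mu> pos_atomic_mono have \<mu>n: "\<mu> \<in> pos_atomic n" by blast
  have "(\<Sum>e\<in>E. norm (snd e - fst e) powr q * c e * real (k e) powr (1 - q))
      \<le> (\<Sum>e\<in>E. a e * (T / S) powr (1 - q))"
  proof (rule sum_mono)
    fix e assume e: "e \<in> E"
    have "norm (snd e - fst e) powr q * c e = a e powr q"
      using q G(4)[OF e] by (simp add: a_def powr_mult powr_powr)
    also have "a e powr q * real (k e) powr (1 - q) \<le> a e * (T / S) powr (1 - q)"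
    proof (cases "a e = 0")
      case False
      with a[of e] have ae: "0 < a e" by simp
      also have "a e \<le> S" unfolding S_def using e a G(2) by (intro member_le_sum) auto
      finally have S: "0 < S" .
      \<comment> \<open>The exponent \<open>1 - q\<close> is negative, so the lower bound on
        \<open>k e\<close> bounds the cost from above.\<close>
      have "real (k e) powr (1 - q) \<le> (T * a e / S) powr (1 - q)"
      proof (rule powr_mono2')
        show "T * a e / S \<le> real (k e)"
          unfolding k_def by linarith
      qed (use q T S ae in auto)
      then have "a e powr q * real (k e) powr (1 - q) \<le> a e powr q * (a e powr (1 - q) * (T / S) powr (1 - q))"
        using T S ae by (intro mult_left_mono) (simp_all add: powr_mult powr_divide mult_ac)
      also have "\<dots> = a e powr (q + (1 - q)) * (T / S) powr (1 - q)"
        by (simp only: powr_add mult.assoc)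
      finally show ?thesis using ae by simp
    qed simp
    finally show "norm (snd e - fst e) powr q * c e * real (k e) powr (1 - q) \<le> a e * (T / S) powr (1 - q)" .
  qed
  also have "(\<Sum>e\<in>E. a e * (T / S) powr (1 - q)) = S * (T / S) powr (1 - q)"
    by (simp add: S_def sum_distrib_right)
  also have "\<dots> = S powr q * T powr (1 - q)"
  proof (cases "S = 0")
    case False
    with S have "S = S powr q * S powr (1 - q)" by (simp flip: powr_add)
    then show ?thesis using S T False by (simp add: powr_divide field_simps)
  qed simp
  finally have sum_le: "(\<Sum>e\<in>E. norm (snd e - fst e) powr q * c e * real (k e) powr (1 - q))
      \<le> S powr q * T powr (1 - q)" .
  have "(INF \<mu> \<in> pos_atomic n. wasserstein q (\<mu> + lp) (\<mu> + lm)) \<le> wasserstein q (\<mu> + lp) (\<mu> + lm)"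
    by (rule cINF_lower[OF bdd_belowI2[where m = 0] \<mu>n]) (simp add: wasserstein_def)
  also note le
  also have "(\<Sum>e\<in>E. norm (snd e - fst e) powr q * c e * real (k e) powr (1 - q)) powr (1 / q)
      \<le> (S powr q * T powr (1 - q)) powr (1 / q)"
    using sum_le q G(4) by (intro powr_mono2 sum_nonneg) auto
  also have "(S powr q * T powr (1 - q)) powr (1 / q) = S * T powr (1 / q - 1)"
    using S T q by (simp add: powr_mult powr_powr diff_divide_distrib)
  finally show ?thesis by (simp add: S_def T_def a_def)
qed

section \<open>Passage to the limit\<close>

text \<open>Adding \<open>\<mu>\<close> to both sides keeps the total masses equal, so the infimum
  is attained and \<open>wasserstein\<close> comes from an actual plan, to which
  \<open>graph_of_transport_plan\<close> applies.\<close>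

lemma optimal_transport_plan:
  fixes \<mu> lp lm :: "'a::euclidean_space atomic_measure"
  assumes "\<And>v. 0 \<le> Poly_Mapping.lookup \<mu> v" "\<And>v. 0 \<le> Poly_Mapping.lookup lp v"
    "\<And>v. 0 \<le> Poly_Mapping.lookup lm v"
    and mass: "(\<Sum>v\<in>Poly_Mapping.keys lp. Poly_Mapping.lookup lp v) = (\<Sum>v\<in>Poly_Mapping.keys lm. Poly_Mapping.lookup lm v)"
  shows "\<exists>\<pi> \<in> transport_plans (\<mu> + lp) (\<mu> + lm).
    wasserstein q (\<mu> + lp) (\<mu> + lm) = transport_cost q (\<mu> + lp) (\<mu> + lm) \<pi> powr (1 / q)"
proof -
  have "(\<Sum>v\<in>Poly_Mapping.keys (\<mu> + l). Poly_Mapping.lookup (\<mu> + l) v)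
      = (\<Sum>v\<in>Poly_Mapping.keys \<mu>. Poly_Mapping.lookup \<mu> v) + (\<Sum>v\<in>Poly_Mapping.keys l. Poly_Mapping.lookup l v)"
    for l :: "'a atomic_measure"
    by (rule setsum_keys_plus_distrib) auto
  then obtain \<pi> where "\<pi> \<in> transport_plans (\<mu> + lp) (\<mu> + lm)"
    "transport_cost q (\<mu> + lp) (\<mu> + lm) \<pi>
      = (INF \<pi> \<in> transport_plans (\<mu> + lp) (\<mu> + lm). transport_cost q (\<mu> + lp) (\<mu> + lm) \<pi>)"
    using transport_cost_attains_INF[of "\<mu> + lp" "\<mu> + lm" q] assms by (auto simp: lookup_add)
  then show ?thesis
    by (intro bexI[of _ \<pi>]) (simp_all add: wasserstein_def)
qed

lemma network_cost_le:
  assumes "(G, c) \<in> weighted_graphs X lam"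
  shows "network_cost q X lam \<le> (\<Sum>e \<in> parcs G. norm (snd e - fst e) * c e powr (1 / q))"
proof -
  have "bdd_below ((\<lambda>(G, c). \<Sum>e \<in> parcs G. norm (snd e - fst e) * c e powr (1 / q)) ` weighted_graphs X lam)"
    by (rule bdd_belowI2[where m = 0]) (auto intro: sum_nonneg)
  from cINF_lower[OF this assms] show ?thesis by (simp add: network_cost_def)
qed

text \<open>Both bounds have the order \<open>n powr (1 / q - 1)\<close> up to a bounded shift of
  \<open>n\<close>: by \<open>card X\<close> below and by the number of vertices of a graph above.
  That graph is chosen nearly optimal before \<open>n\<close> grows, so the shift disappears in the
  limit.\<close>

theorem INF_wasserstein_tendsto_network_cost:
  fixes lp lm :: "'a::euclidean_space atomic_measure"
  assumes X: "finite X" "Poly_Mapping.keys lp \<subseteq> X" "Poly_Mapping.keys lm \<subseteq> X"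
    and nn: "\<And>v. 0 \<le> Poly_Mapping.lookup lp v" "\<And>v. 0 \<le> Poly_Mapping.lookup lm v"
    and mass: "(\<Sum>v\<in>Poly_Mapping.keys lp. Poly_Mapping.lookup lp v) = (\<Sum>v\<in>Poly_Mapping.keys lm. Poly_Mapping.lookup lm v)"
    and q: "1 < q"
  shows "(\<lambda>n. real n powr (1 - 1 / q) *
             (INF \<mu> \<in> pos_atomic n. wasserstein q (\<mu> + lp) (\<mu> + lm)))
           \<longlonglongrightarrow> network_cost q X (lp - lm)"
    (is "(\<lambda>n. _ * ?I n) \<longlonglongrightarrow> ?L")
proof -
  define p where "p = 1 - 1 / q"
  have p: "0 < p" "1 / q - 1 = - p" using q by (simp_all add: p_def)
  have lower: "?L / (real n + real (card X)) powr p \<le> ?I n" for n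
  proof (rule cINF_greatest)
    have "(0 :: 'a atomic_measure) \<in> pos_atomic n" by (simp add: pos_atomic_iff)
    then show "pos_atomic n \<noteq> ({} :: 'a atomic_measure set)" by blast
    fix \<mu> :: "'a atomic_measure" assume \<mu>: "\<mu> \<in> pos_atomic n"
    then obtain \<pi> where \<pi>: "\<pi> \<in> transport_plans (\<mu> + lp) (\<mu> + lm)"
      and W: "wasserstein q (\<mu> + lp) (\<mu> + lm) = transport_cost q (\<mu> + lp) (\<mu> + lm) \<pi> powr (1 / q)"
      using optimal_transport_plan[of \<mu> lp lm q, OF _ nn mass] by (auto simp: pos_atomic_iff)
    obtain G c where G: "(G, c) \<in> weighted_graphs X (lp - lm)"
      and le: "(\<Sum>e \<in> parcs G. norm (snd e - fst e) * c e powr (1 / q))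
        \<le> wasserstein q (\<mu> + lp) (\<mu> + lm) * real (card (Poly_Mapping.keys \<mu>) + card X) powr p"
      using graph_of_transport_plan[OF X \<pi> q] by (auto simp: W p_def)
    note network_cost_le[OF G, of q]
    also note le
    also have "wasserstein q (\<mu> + lp) (\<mu> + lm) * real (card (Poly_Mapping.keys \<mu>) + card X) powr p
        \<le> wasserstein q (\<mu> + lp) (\<mu> + lm) * (real n + real (card X)) powr p"
      using \<mu> p by (intro mult_left_mono powr_mono2) (auto simp: pos_atomic_iff wasserstein_def)
    \<comment> \<open>The denominator vanishes only for \<open>n = 0\<close> and empty
      \<open>X\<close>; the quotient is then zero by convention.\<close>
    finally show "?L / (real n + real (card X)) powr p \<le> wasserstein q (\<mu> + lp) (\<mu> + lm)"
      by (cases "(real n + real (card X)) powr p = 0")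
        (auto simp: wasserstein_def pos_divide_le_eq order_less_le)
  qed
  \<comment> \<open>An infimum below \<open>b\<close> yields a graph of cost below \<open>b\<close>
    only if there is a graph at all. One comes from any plan between \<open>lp\<close> and
    \<open>lm\<close>, that is, from \<open>\<mu> = 0\<close>.\<close>
  have graphs_ne: "weighted_graphs X (lp - lm) \<noteq> {}"
  proof -
    obtain \<pi> where "\<pi> \<in> transport_plans (0 + lp) (0 + lm)"
      using optimal_transport_plan[of 0 lp lm q, OF _ nn mass] by auto
    from graph_of_transport_plan[OF X this q] show ?thesis by blast
  qed
  show ?thesis
  proof (rule order_tendstoI)
    fix a assume "a < ?L"
    moreover have "(\<lambda>n. ?L * (real n powr p / (real n + real (card X)) powr p)) \<longlonglongrightarrow> ?L * 1"
      by (intro tendsto_intros) real_asymp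
    ultimately have "\<forall>\<^sub>F n in sequentially. a < ?L * (real n powr p / (real n + real (card X)) powr p)"
      by (simp add: order_tendstoD)
    then show "\<forall>\<^sub>F n in sequentially. a < real n powr (1 - 1 / q) * ?I n"
    proof (rule eventually_mono)
      fix n assume "a < ?L * (real n powr p / (real n + real (card X)) powr p)"
      also have "\<dots> = real n powr p * (?L / (real n + real (card X)) powr p)" by simp
      also have "\<dots> \<le> real n powr p * ?I n" by (intro mult_left_mono lower) auto
      finally show "a < real n powr (1 - 1 / q) * ?I n" by (simp add: p_def)
    qed
  next
    fix b assume "?L < b"
    then obtain G c where G: "(G, c) \<in> weighted_graphs X (lp - lm)"
      and "(\<Sum>e \<in> parcs G. norm (snd e - fst e) * c e powr (1 / q)) < b"
      using cInf_lessD[of "(\<lambda>(G, c). \<Sum>e \<in> parcs G. norm (snd e - fst e) * c e powr (1 / q)) ` weighted_graphs X (lp - lm)" b]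
        graphs_ne by (auto simp: network_cost_def)
    moreover define S where "S = (\<Sum>e \<in> parcs G. norm (snd e - fst e) * c e powr (1 / q))"
    ultimately have "S < b" by simp
    define V where "V = card (pverts G)"
    have "(\<lambda>n. S * (real n powr p * (real n - real V) powr (- p))) \<longlonglongrightarrow> S * 1"
      by (intro tendsto_intros) real_asymp
    then have "\<forall>\<^sub>F n in sequentially. S * (real n powr p * (real n - real V) powr (- p)) < b"
      using \<open>S < b\<close> by (simp add: order_tendstoD)
    then show "\<forall>\<^sub>F n in sequentially. real n powr (1 - 1 / q) * ?I n < b"
      using eventually_gt_at_top[of V]
    proof eventually_elim
      case (elim n)
      have "?I n \<le> S * (real n - real V) powr (1 / q - 1)"
        unfolding S_def V_def
        using G[unfolded weighted_graphs_iff] X nn q elim(2)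
        by (intro INF_wasserstein_le) (auto simp: V_def)
      then have "real n powr p * ?I n \<le> real n powr p * (S * (real n - real V) powr (- p))"
        unfolding p(2) by (intro mult_left_mono) auto
      with elim(1) show ?case by (simp add: p_def mult_ac)
    qed
  qed
qed

theorem theorem2p1:
  fixes x y :: "nat \<Rightarrow> real ^ 'k"
    and m ms :: "nat \<Rightarrow> real"
    and N :: nat
    and q :: real
    and lam_pos lam_neg lam :: "(real ^ 'k) atomic_measure"
  assumes "1 \<le> N"
    and "\<And>i. i \<in> {1..N} \<Longrightarrow> 0 \<le> m i"
    and "\<And>i. i \<in> {1..N} \<Longrightarrow> 0 \<le> ms i"
    and "(\<Sum>i = 1..N. m i) = (\<Sum>i = 1..N. ms i)"
    and "0 < (\<Sum>i = 1..N. m i)"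
    and "lam_pos = sum_dirac N m x"
    and "lam_neg = sum_dirac N ms y"
    and "lam = lam_pos - lam_neg"
    and "1 < q"
  shows "(\<lambda>n. real n powr (1 - 1 / q) *
             (INF \<mu> \<in> pos_atomic n. wasserstein q (\<mu> + lam_pos) (\<mu> + lam_neg)))
           \<longlonglongrightarrow> network_cost q (x ` {1..N} \<union> y ` {1..N}) lam"
proof -
  have "(\<lambda>n. real n powr (1 - 1 / q) *
             (INF \<mu> \<in> pos_atomic n. wasserstein q (\<mu> + lam_pos) (\<mu> + lam_neg)))
           \<longlonglongrightarrow> network_cost q (x ` {1..N} \<union> y ` {1..N}) (lam_pos - lam_neg)"
  proof (rule INF_wasserstein_tendsto_network_cost)
    have "lam_pos \<in> pos_atomic N" "lam_neg \<in> pos_atomic N"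
      using assms(2,3,6,7) unfolding pos_atomic_def by blast+
    then show "0 \<le> Poly_Mapping.lookup lam_pos v" "0 \<le> Poly_Mapping.lookup lam_neg v" for v
      by (auto simp: pos_atomic_iff)
    show "Poly_Mapping.keys lam_pos \<subseteq> x ` {1..N} \<union> y ` {1..N}"
      unfolding assms(6) by (rule le_supI1[OF keys_sum_dirac])
    show "Poly_Mapping.keys lam_neg \<subseteq> x ` {1..N} \<union> y ` {1..N}"
      unfolding assms(7) by (rule le_supI2[OF keys_sum_dirac])
  qed (use assms(4,9) in \<open>auto simp: assms(6,7) sum_lookup_sum_dirac\<close>)
  then show ?thesis by (simp only: assms(8))
qed

end
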